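(* Let $s\in(0,1)$. For pairs of tetrahedra of the mesh that are identical, or have exactly a common face, exactly a common edge, or exactly a common vertex, the respective regularized integrands $\tilde k_{1,T}:[0,1]^2\to\mathbb R$, $\tilde k_{1,F}:[0,1]^3\to\mathbb R$, $\tilde k_{1,E}:[0,1]^4\to\mathbb R$ and $\tilde k_{1,V}:[0,1]^5\to\mathbb R$ are componentwise analytic.
   Context: **Componentwise analytic.** For $\rho>1/2$ let $\mathcal E_\rho\subset\mathbb C$ be the closed ellipse with foci $0$ and $1$ whose semi-axes have sum $\rho$. A function $f:[0,1]^k\to\mathbb C$ is componentwise analytic if for each $i=1,\dots,k$ there is $\rho_i>1/2$ such that for every $x\in[0,1]^k$ the function $t\mapsto f(x_1,\dots,x_{i-1},t,x_{i+1},\dots,x_k)$ on $[0,1]$ extends to an analytic function on $\mathcal E_{\rho_i}$. **Meshes.** $\Omega\subset\mathbb R^3$ is a bounded polyhedral Lipschitz domain with a conforming partition $\mathcal T$ into closed nondegenerate tetrahedra; the minimal interior angle of each tetrahedron (smallest among planar angles of its faces and its dihedral angles) is larger than $\theta_{\mathcal T}>0$, and there are $c_1,c_2>0$ with $c_1h_{t_1}\le h_{t_2}\le c_2h_{t_1}$ for all $t_1,t_2\in\mathcal T$, $h_t$ being the diameter of $t$. There is $c_A>0$ such that whenever $t_1\ne t_2$ in $\mathcal T$ intersect exactly in a common vertex, edge or face $S$, for all $x\in t_1$, $y\in t_2$ there is $p\in S$ with $|x-y|\ge c_A(|x-p|+|p-y|)$. $\varphi_1,\dots,\varphi_N$ is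 the nodal basis (one function per inner node) of the continuous piecewise linear functions on $\mathcal T$ vanishing on $\partial\Omega$. **Reference map.** For a tetrahedron $t$ with vertices $a_t,b_t,c_t,d_t$: $\chi_t(\tilde x)=M_t\tilde x+a_t$, $M_t=[b_t-a_t,c_t-b_t,d_t-b_t]$, mapping $\tilde t=\{\tilde x\in\mathbb R^3:0\le\tilde x_1\le1,\ 0\le\tilde x_2\le\tilde x_1,\ 0\le\tilde x_3\le\tilde x_1-\tilde x_2\}$ onto $t$. $\lambda_i^t$ is the affine function on $\mathbb R^3$ coinciding with $\varphi_i$ on $t$. For a pair $t_1,t_2$ the vertices are ordered so that common ones come first, in the same order (V: $a_{t_1}=a_{t_2}$; E: also $b_{t_1}=b_{t_2}$; F: also $c_{t_1}=c_{t_2}$; T: all equal). For given indices $i,j$, $$\tilde k_1(\tilde x,\tilde y)=\frac{\prod_{\star\in\{i,j\}}[\lambda_\star^{t_1}(\chi_{t_1}(\tilde x))-\lambda_\star^{t_2}(\chi_{t_2}(\tilde y))]}{|\chi_{t_1}(\tilde x)-\chi_{t_2}(\tilde y)|^{3+2s}}|\det M_{t_1}||\det M_{t_2}|$$ for all $\tilde x,\tilde y\in\mathbb R^3$ with nonzero denominator. **Regularized integrands.** $\tilde k_{1,\star}(\eta)=\sum_m\tilde k_1(\mathscr D_m(\eta))J_m(\eta)$ with the following $\mathscr D_m=(\mathscr D^1_m,\mathscr D^2_m)$; $\mathscr D^T$ denotes the pair with its two components interchanged. (V, common vertex) $\mathscr D_1=\big((1,\eta_1\eta_2,\eta_1(1-\eta_2)),(\eta_3,\eta_3\eta_4\eta_5,\eta_3\eta_4(1-\eta_5))\big)$,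 $\mathscr D_2=\mathscr D_1^T$, $J_1=J_2=\eta_1\eta_3^2\eta_4$. (E, common edge) $\mathscr D_1=\big((0,\eta_1,1-\eta_1),(-\eta_2\eta_3\eta_4,\eta_2\eta_3(1-\eta_4),\eta_2(1-\eta_3))\big)$, $\mathscr D_2=\big((0,\eta_3\eta_4,\eta_3(1-\eta_4)),(-\eta_1\eta_2,\eta_1(1-\eta_2),1-\eta_1)\big)$, $\mathscr D_3=\mathscr D_1^T$, $\mathscr D_4=\mathscr D_2^T$; $J_1=J_3=\eta_2^2\eta_3$, $J_2=J_4=\eta_1\eta_3$. (F, common face) $\mathscr D_1=((0,\eta_1,1-\eta_1),(-\eta_1\eta_2\eta_3,0,\eta_1\eta_2(1-\eta_3)))$, $\mathscr D_2=((0,\eta_1\eta_2,\eta_1(1-\eta_2)),(-\eta_1\eta_2\eta_3,0,1-\eta_1\eta_2\eta_3))$, $\mathscr D_3=((0,\eta_1\eta_2,1-\eta_1\eta_2),(-\eta_1\eta_2\eta_3,0,\eta_1(1-\eta_2\eta_3)))$, $\mathscr D_4=((0,\eta_1\eta_2\eta_3,\eta_1\eta_2(1-\eta_3)),(-\eta_1,0,1-\eta_1))$, $\mathscr D_5=((0,\eta_1\eta_2\eta_3,\eta_1(1-\eta_2\eta_3)),(-\eta_1\eta_2,0,1-\eta_1\eta_2))$, $\mathscr D_6=((0,\eta_1\eta_2\eta_3,1-\eta_1\eta_2\eta_3),(-\eta_1\eta_2,0,\eta_1(1-\eta_2)))$, $\mathscr D_7=((0,0,1),(-\eta_1\eta_2\eta_3,\eta_1\eta_2(1-\eta_3),\eta_1(1-\eta_2)))$,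 $\mathscr D_{7+i}=\mathscr D_i^T$ for $i=1,\dots,7$, $\mathscr D_{15}=((-\eta_1\eta_2\eta_3,\eta_1\eta_2(1-\eta_3),1-\eta_1\eta_2),(0,0,\eta_1))$, $\mathscr D_{16}=((0,0,\eta_3),(-\eta_1\eta_2,\eta_1(1-\eta_2),1-\eta_1))$, $\mathscr D_{17}=((-\eta_1\eta_2,\eta_1(1-\eta_2),1-\eta_1),(0,0,\eta_1\eta_3))$; $J_m=\eta_1^2\eta_2$ for $m\le15$, $J_{16}=\eta_1$, $J_{17}=\eta_1^2$. (T, identical, $t_1=t_2$, $m=1,\dots,9$) $\mathscr D_1=((0,\eta_1,-\eta_1),(-\eta_1\eta_2,0,-1))$, $\mathscr D_2=((0,1,0),(-\eta_1\eta_2,0,\eta_1(1-\eta_2)))$, $\mathscr D_3=((0,\eta_1,-1),(-\eta_1\eta_2,0,-\eta_1\eta_2))$, $\mathscr D_4=((0,\eta_1\eta_2,-\eta_1\eta_2),(-\eta_1,0,-1))$, $\mathscr D_5=((0,\eta_1\eta_2,\eta_1(1-\eta_2)),(-1,0,0))$, $\mathscr D_6=((0,\eta_1\eta_2,-1),(-\eta_1,0,-\eta_1))$, $\mathscr D_7=((0,0,0),(-\eta_1\eta_2,\eta_1(1-\eta_2),-1))$, $\mathscr D_8=((0,0,-1),(-\eta_1\eta_2,\eta_1(1-\eta_2),-\eta_1))$, $\mathscr D_9=((0,0,\eta_1),(-\eta_2,1-\eta_2,0))$; $J_m=\eta_1$ for $m\le8$, $J_9=1$. *)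

theory Defs
  imports "HOL-Analysis.Analysis"
begin

text \<open>The filled closed ellipse with foci 0 and 1 and semi-axes \<open>a \<ge> b > 0\<close> consists of the points
  whose distances to the foci add up to at most \<open>2 * a\<close>.  From \<open>a + b = \<rho>\<close> and
  \<open>a\<^sup>2 - b\<^sup>2 = (1/2)\<^sup>2\<close> (half the focal distance) one gets \<open>a - b = 1 / (4 * \<rho>)\<close>, so
  \<open>2 * a = \<rho> + 1 / (4 * \<rho>)\<close>.\<close>

definition closed_ellipse :: "real \<Rightarrow> complex set" where
  "closed_ellipse \<rho> = {z. cmod z + cmod (z - 1) \<le> \<rho> + 1 / (4 * \<rho>)}"

definition unit_cube :: "(real ^ 'k) set" where
  "unit_cube = {x. \<forall>i. 0 \<le> x $ i \<and> x $ i \<le> 1}"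

definition componentwise_analytic :: "(real ^ 'k \<Rightarrow> complex) \<Rightarrow> bool" where
  "componentwise_analytic f \<longleftrightarrow>
     (\<forall>i. \<exists>\<rho> > 1/2. \<forall>x \<in> unit_cube. \<exists>g. g analytic_on closed_ellipse \<rho> \<and>
        (\<forall>t \<in> {0..1}. g (complex_of_real t) = f (\<chi> l. if l = i then t else x $ l)))"

text \<open>Near every boundary point, and after an orthogonal change of coordinates, the domain is the
  region strictly above the graph of a Lipschitz function.\<close>

definition lipschitz_boundary :: "(real ^ 3) set \<Rightarrow> bool" where
  "lipschitz_boundary \<Omega> \<longleftrightarrow>
     (\<forall>p \<in> frontier \<Omega>. \<exists>U Q \<gamma> L. open U \<and> p \<in> U \<and>
        orthogonal_transformation (Q :: real ^ 3 \<Rightarrow> real ^ 3) \<and>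
        lipschitz_on L UNIV (\<gamma> :: real \<times> real \<Rightarrow> real) \<and>
        \<Omega> \<inter> U = {x \<in> U. \<gamma> (Q x $ 1, Q x $ 2) < Q x $ 3})"

definition polyhedral_boundary :: "(real ^ 3) set \<Rightarrow> bool" where
  "polyhedral_boundary \<Omega> \<longleftrightarrow>
     (\<exists>F. finite F \<and> (\<forall>P \<in> F. polytope P \<and> aff_dim P = 2) \<and> frontier \<Omega> = \<Union>F)"

definition polyhedral_lipschitz_domain :: "(real ^ 3) set \<Rightarrow> bool" where
  "polyhedral_lipschitz_domain \<Omega> \<longleftrightarrow>
     open \<Omega> \<and> connected \<Omega> \<and> \<Omega> \<noteq> {} \<and> bounded \<Omega> \<and> polyhedral_boundary \<Omega> \<and> lipschitz_boundary \<Omega>"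

definition vertices :: "(real ^ 3) set \<Rightarrow> (real ^ 3) set" where
  "vertices t = {v. v extreme_point_of t}"

definition angle_between :: "real ^ 3 \<Rightarrow> real ^ 3 \<Rightarrow> real" where
  "angle_between u v = arccos ((u \<bullet> v) / (norm u * norm v))"

definition planar_angles :: "(real ^ 3) set \<Rightarrow> real set" where
  "planar_angles t =
     {angle_between (q - p) (r - p) | p q r. {p, q, r} \<subseteq> vertices t \<and> distinct [p, q, r]}"

text \<open>The component of \<open>u\<close> orthogonal to \<open>e\<close>.  The dihedral angle at the edge from \<open>p\<close> to \<open>q\<close> is the
  angle between the parts of the two adjacent faces orthogonal to that edge.\<close>

definition orth_part :: "real ^ 3 \<Rightarrow> real ^ 3 \<Rightarrow> real ^ 3" where
  "orth_part e u = u - ((u \<bullet> e) / (e \<bullet> e)) *\<^sub>R e"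

definition dihedral_angles :: "(real ^ 3) set \<Rightarrow> real set" where
  "dihedral_angles t =
     {angle_between (orth_part (q - p) (r - p)) (orth_part (q - p) (w - p)) | p q r w.
        {p, q, r, w} \<subseteq> vertices t \<and> distinct [p, q, r, w]}"

definition min_interior_angle :: "(real ^ 3) set \<Rightarrow> real" where
  "min_interior_angle t = Min (planar_angles t \<union> dihedral_angles t)"

text \<open>The library predicate \<open>triangulation\<close> supplies finiteness and conformity: any two elements
  meet in a common (possibly empty) face.\<close>

definition conforming_tetrahedral_partition :: "(real ^ 3) set \<Rightarrow> (real ^ 3) set set \<Rightarrow> bool" where
  "conforming_tetrahedral_partition \<Omega> \<T> \<longleftrightarrow>
     triangulation \<T> \<and> (\<forall>t \<in> \<T>. 3 simplex t) \<and> \<Union>\<T> = closure \<Omega>"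

text \<open>In the last condition the common vertex, edge or face is \<open>t1 \<inter> t2\<close>, by conformity.\<close>

definition admissible_mesh ::
    "(real ^ 3) set \<Rightarrow> (real ^ 3) set set \<Rightarrow> real \<Rightarrow> real \<Rightarrow> real \<Rightarrow> real \<Rightarrow> bool" where
  "admissible_mesh \<Omega> \<T> \<theta> c1 c2 cA \<longleftrightarrow>
     polyhedral_lipschitz_domain \<Omega> \<and>
     conforming_tetrahedral_partition \<Omega> \<T> \<and>
     0 < \<theta> \<and> (\<forall>t \<in> \<T>. \<theta> < min_interior_angle t) \<and>
     0 < c1 \<and> 0 < c2 \<and>
     (\<forall>t1 \<in> \<T>. \<forall>t2 \<in> \<T>. c1 * diameter t1 \<le> diameter t2 \<and> diameter t2 \<le> c2 * diameter t1) \<and>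
     0 < cA \<and>
     (\<forall>t1 \<in> \<T>. \<forall>t2 \<in> \<T>. t1 \<noteq> t2 \<and> t1 \<inter> t2 \<noteq> {} \<longrightarrow>
        (\<forall>x \<in> t1. \<forall>y \<in> t2. \<exists>p \<in> t1 \<inter> t2. norm (x - y) \<ge> cA * (norm (x - p) + norm (p - y))))"

definition affine_fun :: "(real ^ 3 \<Rightarrow> real) \<Rightarrow> bool" where
  "affine_fun f \<longleftrightarrow> (\<exists>a b. \<forall>x. f x = a \<bullet> x + b)"

definition p1_space :: "(real ^ 3) set \<Rightarrow> (real ^ 3) set set \<Rightarrow> (real ^ 3 \<Rightarrow> real) set" where
  "p1_space \<Omega> \<T> =
     {u. continuous_on (closure \<Omega>) u \<and>
         (\<forall>t \<in> \<T>. \<exists>f. affine_fun f \<and> (\<forall>x \<in> t. u x = f x)) \<and>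
         (\<forall>x \<in> frontier \<Omega>. u x = 0)}"

definition inner_nodes :: "(real ^ 3) set \<Rightarrow> (real ^ 3) set set \<Rightarrow> (real ^ 3) set" where
  "inner_nodes \<Omega> \<T> = (\<Union>t \<in> \<T>. vertices t) \<inter> \<Omega>"

text \<open>The basis functions are \<open>\<phi> 1, \<dots>, \<phi> N\<close>; only their values on \<open>closure \<Omega>\<close> matter.\<close>

definition nodal_basis ::
    "(real ^ 3) set \<Rightarrow> (real ^ 3) set set \<Rightarrow> nat \<Rightarrow> (nat \<Rightarrow> real ^ 3 \<Rightarrow> real) \<Rightarrow> bool" where
  "nodal_basis \<Omega> \<T> N \<phi> \<longleftrightarrow>
     (\<exists>\<nu>. bij_betw \<nu> {1..N} (inner_nodes \<Omega> \<T>) \<and>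
        (\<forall>i \<in> {1..N}. \<phi> i \<in> p1_space \<Omega> \<T> \<and>
           (\<forall>j \<in> {1..N}. \<phi> i (\<nu> j) = (if i = j then 1 else 0))))"

text \<open>The affine function on the whole space which agrees with \<open>\<psi>\<close> on \<open>t\<close>; it is unique when \<open>t\<close>
  is a nondegenerate tetrahedron.\<close>

definition affine_ext :: "(real ^ 3 \<Rightarrow> real) \<Rightarrow> (real ^ 3) set \<Rightarrow> real ^ 3 \<Rightarrow> real" where
  "affine_ext \<psi> t = (THE f. affine_fun f \<and> (\<forall>x \<in> t. f x = \<psi> x))"

text \<open>A list \<open>p = [a, b, c, d]\<close> orders the vertices of a tetrahedron.  The columns of its matrix are
  \<open>b - a\<close>, \<open>c - b\<close>, \<open>d - b\<close>.\<close>

definition ref_matrix :: "(real ^ 3) list \<Rightarrow> real ^ 3 ^ 3" where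
  "ref_matrix p = transpose (vector [p ! 1 - p ! 0, p ! 2 - p ! 1, p ! 3 - p ! 1])"

definition ref_map :: "(real ^ 3) list \<Rightarrow> real ^ 3 \<Rightarrow> real ^ 3" where
  "ref_map p x = ref_matrix p *v x + p ! 0"

definition vertex_ordering :: "(real ^ 3) set \<Rightarrow> (real ^ 3) list \<Rightarrow> bool" where
  "vertex_ordering t p \<longleftrightarrow> distinct p \<and> set p = vertices t"

text \<open>The tetrahedra intersect exactly in a common vertex (\<open>k = 1\<close>), edge (\<open>k = 2\<close>) or face
  (\<open>k = 3\<close>), or are identical (\<open>k = 4\<close>), and \<open>p1\<close>, \<open>p2\<close> list the common vertices first, in the
  same order.\<close>

definition common_vertices_first ::
    "nat \<Rightarrow> (real ^ 3) set \<Rightarrow> (real ^ 3) set \<Rightarrow> (real ^ 3) list \<Rightarrow> (real ^ 3) list \<Rightarrow> bool" where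
  "common_vertices_first k t1 t2 p1 p2 \<longleftrightarrow>
     vertex_ordering t1 p1 \<and> vertex_ordering t2 p2 \<and> take k p1 = take k p2 \<and>
     t1 \<inter> t2 = convex hull (set (take k p1))"

definition kt_denom :: "real \<Rightarrow> (real ^ 3) list \<Rightarrow> (real ^ 3) list \<Rightarrow> (real ^ 3) \<times> (real ^ 3) \<Rightarrow> real" where
  "kt_denom s p1 p2 = (\<lambda>(x, y). norm (ref_map p1 x - ref_map p2 y) powr (3 + 2 * s))"

text \<open>The numerator has one factor for each of \<open>\<psi>\<close> and \<open>\<psi>'\<close>, so a square if they coincide.\<close>

definition kt ::
    "real \<Rightarrow> (real ^ 3 \<Rightarrow> real) \<Rightarrow> (real ^ 3 \<Rightarrow> real) \<Rightarrow> (real ^ 3) set \<Rightarrow> (real ^ 3) set \<Rightarrow>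
     (real ^ 3) list \<Rightarrow> (real ^ 3) list \<Rightarrow> (real ^ 3) \<times> (real ^ 3) \<Rightarrow> real" where
  "kt s \<psi> \<psi>' t1 t2 p1 p2 = (\<lambda>(x, y).
     (affine_ext \<psi> t1 (ref_map p1 x) - affine_ext \<psi> t2 (ref_map p2 y)) *
     (affine_ext \<psi>' t1 (ref_map p1 x) - affine_ext \<psi>' t2 (ref_map p2 y)) /
     kt_denom s p1 p2 (x, y) *
     \<bar>det (ref_matrix p1)\<bar> * \<bar>det (ref_matrix p2)\<bar>)"

text \<open>Each transformation is a pair of a map into pairs of reference points and its weight.  The
  index literals \<open>1, \<dots>, k\<close> denote the \<open>k\<close> distinct elements of the numeral type \<open>k\<close>, in which
  \<open>k\<close> itself is \<open>0\<close>.\<close>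

type_synonym 'k transf = "(real ^ 'k \<Rightarrow> (real ^ 3) \<times> (real ^ 3)) \<times> (real ^ 'k \<Rightarrow> real)"

definition transp :: "'k transf \<Rightarrow> 'k transf" where
  "transp = (\<lambda>(D, J). (prod.swap \<circ> D, J))"

abbreviation vec3 :: "real \<Rightarrow> real \<Rightarrow> real \<Rightarrow> real ^ 3" where
  "vec3 x y z \<equiv> vector [x, y, z]"

definition transf_V :: "5 transf list" where
  "transf_V =
    (let D1 = (\<lambda>\<eta>. (vec3 1 (\<eta>$1 * \<eta>$2) (\<eta>$1 * (1 - \<eta>$2)),
                     vec3 (\<eta>$3) (\<eta>$3 * \<eta>$4 * \<eta>$5) (\<eta>$3 * \<eta>$4 * (1 - \<eta>$5))),
               \<lambda>\<eta>. \<eta>$1 * (\<eta>$3)^2 * \<eta>$4)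
     in [D1, transp D1])"

definition transf_E :: "4 transf list" where
  "transf_E =
    (let D1 = (\<lambda>\<eta>. (vec3 0 (\<eta>$1) (1 - \<eta>$1),
                     vec3 (- (\<eta>$2 * \<eta>$3 * \<eta>$4)) (\<eta>$2 * \<eta>$3 * (1 - \<eta>$4)) (\<eta>$2 * (1 - \<eta>$3))),
               \<lambda>\<eta>. (\<eta>$2)^2 * \<eta>$3);
         D2 = (\<lambda>\<eta>. (vec3 0 (\<eta>$3 * \<eta>$4) (\<eta>$3 * (1 - \<eta>$4)),
                     vec3 (- (\<eta>$1 * \<eta>$2)) (\<eta>$1 * (1 - \<eta>$2)) (1 - \<eta>$1)),
               \<lambda>\<eta>. \<eta>$1 * \<eta>$3)
     in [D1, D2, transp D1, transp D2])"

definition transf_F :: "3 transf list" where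
  "transf_F =
    (let J = (\<lambda>\<eta>. (\<eta>$1)^2 * \<eta>$2);
         D1 = (\<lambda>\<eta>. (vec3 0 (\<eta>$1) (1 - \<eta>$1),
                     vec3 (- (\<eta>$1 * \<eta>$2 * \<eta>$3)) 0 (\<eta>$1 * \<eta>$2 * (1 - \<eta>$3))), J);
         D2 = (\<lambda>\<eta>. (vec3 0 (\<eta>$1 * \<eta>$2) (\<eta>$1 * (1 - \<eta>$2)),
                     vec3 (- (\<eta>$1 * \<eta>$2 * \<eta>$3)) 0 (1 - \<eta>$1 * \<eta>$2 * \<eta>$3)), J);
         D3 = (\<lambda>\<eta>. (vec3 0 (\<eta>$1 * \<eta>$2) (1 - \<eta>$1 * \<eta>$2),
                     vec3 (- (\<eta>$1 * \<eta>$2 * \<eta>$3)) 0 (\<eta>$1 * (1 - \<eta>$2 * \<eta>$3))), J);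
         D4 = (\<lambda>\<eta>. (vec3 0 (\<eta>$1 * \<eta>$2 * \<eta>$3) (\<eta>$1 * \<eta>$2 * (1 - \<eta>$3)),
                     vec3 (- (\<eta>$1)) 0 (1 - \<eta>$1)), J);
         D5 = (\<lambda>\<eta>. (vec3 0 (\<eta>$1 * \<eta>$2 * \<eta>$3) (\<eta>$1 * (1 - \<eta>$2 * \<eta>$3)),
                     vec3 (- (\<eta>$1 * \<eta>$2)) 0 (1 - \<eta>$1 * \<eta>$2)), J);
         D6 = (\<lambda>\<eta>. (vec3 0 (\<eta>$1 * \<eta>$2 * \<eta>$3) (1 - \<eta>$1 * \<eta>$2 * \<eta>$3),
                     vec3 (- (\<eta>$1 * \<eta>$2)) 0 (\<eta>$1 * (1 - \<eta>$2))), J);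
         D7 = (\<lambda>\<eta>. (vec3 0 0 1,
                     vec3 (- (\<eta>$1 * \<eta>$2 * \<eta>$3)) (\<eta>$1 * \<eta>$2 * (1 - \<eta>$3)) (\<eta>$1 * (1 - \<eta>$2))), J);
         D15 = (\<lambda>\<eta>. (vec3 (- (\<eta>$1 * \<eta>$2 * \<eta>$3)) (\<eta>$1 * \<eta>$2 * (1 - \<eta>$3)) (1 - \<eta>$1 * \<eta>$2),
                      vec3 0 0 (\<eta>$1)), J);
         D16 = (\<lambda>\<eta>. (vec3 0 0 (\<eta>$3),
                      vec3 (- (\<eta>$1 * \<eta>$2)) (\<eta>$1 * (1 - \<eta>$2)) (1 - \<eta>$1)), \<lambda>\<eta>. \<eta>$1);
         D17 = (\<lambda>\<eta>. (vec3 (- (\<eta>$1 * \<eta>$2)) (\<eta>$1 * (1 - \<eta>$2)) (1 - \<eta>$1),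
                      vec3 0 0 (\<eta>$1 * \<eta>$3)), \<lambda>\<eta>. (\<eta>$1)^2)
     in [D1, D2, D3, D4, D5, D6, D7] @ map transp [D1, D2, D3, D4, D5, D6, D7] @ [D15, D16, D17])"

definition transf_T :: "2 transf list" where
  "transf_T =
    (let J = (\<lambda>\<eta>. \<eta>$1) in
     [(\<lambda>\<eta>. (vec3 0 (\<eta>$1) (- (\<eta>$1)), vec3 (- (\<eta>$1 * \<eta>$2)) 0 (-1)), J),
      (\<lambda>\<eta>. (vec3 0 1 0, vec3 (- (\<eta>$1 * \<eta>$2)) 0 (\<eta>$1 * (1 - \<eta>$2))), J),
      (\<lambda>\<eta>. (vec3 0 (\<eta>$1) (-1), vec3 (- (\<eta>$1 * \<eta>$2)) 0 (- (\<eta>$1 * \<eta>$2))), J),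
      (\<lambda>\<eta>. (vec3 0 (\<eta>$1 * \<eta>$2) (- (\<eta>$1 * \<eta>$2)), vec3 (- (\<eta>$1)) 0 (-1)), J),
      (\<lambda>\<eta>. (vec3 0 (\<eta>$1 * \<eta>$2) (\<eta>$1 * (1 - \<eta>$2)), vec3 (-1) 0 0), J),
      (\<lambda>\<eta>. (vec3 0 (\<eta>$1 * \<eta>$2) (-1), vec3 (- (\<eta>$1)) 0 (- (\<eta>$1))), J),
      (\<lambda>\<eta>. (vec3 0 0 0, vec3 (- (\<eta>$1 * \<eta>$2)) (\<eta>$1 * (1 - \<eta>$2)) (-1)), J),
      (\<lambda>\<eta>. (vec3 0 0 (-1), vec3 (- (\<eta>$1 * \<eta>$2)) (\<eta>$1 * (1 - \<eta>$2)) (- (\<eta>$1))), J),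
      (\<lambda>\<eta>. (vec3 0 0 (\<eta>$1), vec3 (- (\<eta>$2)) (1 - \<eta>$2) 0), \<lambda>\<eta>. 1)])"

definition regularized :: "('k :: finite) transf list \<Rightarrow> ((real ^ 3) \<times> (real ^ 3) \<Rightarrow> real) \<Rightarrow> real ^ 'k \<Rightarrow> real" where
  "regularized Ds k \<eta> = (\<Sum>(D, J) \<leftarrow> Ds. k (D \<eta>) * J \<eta>)"

text \<open>The kernel is meaningful only where its denominator is nonzero (the value 0 that Isabelle/HOL
  assigns elsewhere is an artefact).  This says that the regularized integrand is a genuine function
  on the whole cube, i.e. that no summand is evaluated at a zero of the denominator.\<close>

definition denom_nonzero :: "('k :: finite) transf list \<Rightarrow> ((real ^ 3) \<times> (real ^ 3) \<Rightarrow> real) \<Rightarrow> bool" where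
  "denom_nonzero Ds d \<longleftrightarrow> (\<forall>\<eta> \<in> unit_cube. \<forall>(D, J) \<in> set Ds. d (D \<eta>) \<noteq> 0)"

end

theory Submission
  imports Defs
begin

text \<open>In each coordinate the regularized integrand is a sum of terms \<open>n * q powr a\<close>, where \<open>n\<close> and
  \<open>q\<close> are polynomials and \<open>q\<close> is the squared distance of the two image points.  If \<open>q > 0\<close> on the
  whole cube, then by compactness \<open>Re q > 0\<close> on an ellipse around \<open>{0..1}\<close> chosen uniformly in the
  other coordinates, and the principal branch of the power extends the term.  Positivity of \<open>q\<close> is a
  fact about tetrahedra: pushing two coinciding image points towards the barycentre of the common
  face moves them into both tetrahedra, hence into the common face, so that all barycentric
  coordinates at the remaining vertices vanish.  None of the transformations produces such a pair.\<close>

section \<open>Componentwise entire functions\<close>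

definition set_coord :: "'k \<Rightarrow> real \<Rightarrow> real ^ 'k \<Rightarrow> real ^ 'k" where
  "set_coord i t x = (\<chi> l. if l = i then t else x $ l)"

text \<open>A class closed under ring operations that contains all polynomials. Joint continuity in
  parameter and complex variable is what the later compactness argument needs. The
  \<open>i\<close>-th coordinate of \<open>x\<close> is a dummy, overwritten by
  \<open>set_coord\<close>, so that the parameter can range over the whole cube.\<close>

definition componentwise_entire :: "(real ^ 'k \<Rightarrow> real) \<Rightarrow> bool" where
  "componentwise_entire f \<longleftrightarrow>
     (\<forall>i. \<exists>G. continuous_on UNIV (\<lambda>(x, z). G x z) \<and> (\<forall>x. G x analytic_on UNIV) \<and>
        (\<forall>x t. G x (complex_of_real t) = complex_of_real (f (set_coord i t x))))"

lemma componentwise_entireE: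
  assumes "componentwise_entire f"
  obtains G where "continuous_on UNIV (\<lambda>p. G (fst p) (snd p))" "\<And>x. G x analytic_on UNIV"
    "\<And>x t. G x (complex_of_real t) = complex_of_real (f (set_coord i t x))"
  using assms unfolding componentwise_entire_def case_prod_beta by metis

lemma componentwise_entireI:
  assumes "\<And>i. \<exists>G. continuous_on UNIV (\<lambda>p. G (fst p) (snd p)) \<and> (\<forall>x. G x analytic_on UNIV) \<and>
        (\<forall>x t. G x (complex_of_real t) = complex_of_real (f (set_coord i t x)))"
  shows "componentwise_entire f"
  using assms unfolding componentwise_entire_def case_prod_beta by blast

named_theorems componentwise_entire_intros

lemma componentwise_entire_const [componentwise_entire_intros]: "componentwise_entire (\<lambda>\<eta>. c)"
proof (rule componentwise_entireI)
  show "\<exists>G. continuous_on UNIV (\<lambda>p. G (fst p) (snd p)) \<and> (\<forall>x. G x analytic_on UNIV) \<and>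
      (\<forall>x t. G x (complex_of_real t) = complex_of_real c)" for i :: 'a
    by (rule exI[of _ "\<lambda>x z. complex_of_real c"]) (auto intro: continuous_intros)
qed

lemma componentwise_entire_nth [componentwise_entire_intros]: "componentwise_entire (\<lambda>\<eta>. \<eta> $ l)"
proof (rule componentwise_entireI)
  show "\<exists>G. continuous_on UNIV (\<lambda>p. G (fst p) (snd p)) \<and> (\<forall>x. G x analytic_on UNIV) \<and>
      (\<forall>x t. G x (complex_of_real t) = complex_of_real (set_coord i t x $ l))" for i
  proof (cases "l = i")
    case True
    then show ?thesis
      by (intro exI[of _ "\<lambda>x z. z"])
        (auto simp: set_coord_def analytic_on_ident intro: continuous_intros)
  next
    case False
    then show ?thesis
      by (intro exI[of _ "\<lambda>x z. complex_of_real (x $ l)"])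
        (auto simp: set_coord_def intro!: continuous_intros)
  qed
qed

lemma componentwise_entire_add [componentwise_entire_intros]:
  assumes "componentwise_entire f" "componentwise_entire g"
  shows "componentwise_entire (\<lambda>\<eta>. f \<eta> + g \<eta>)"
proof (rule componentwise_entireI)
  fix i
  obtain F where F: "continuous_on UNIV (\<lambda>p. F (fst p) (snd p))" "\<And>x. F x analytic_on UNIV"
    "\<And>x t. F x (complex_of_real t) = complex_of_real (f (set_coord i t x))"
    using componentwise_entireE[OF assms(1)] by metis
  obtain G where G: "continuous_on UNIV (\<lambda>p. G (fst p) (snd p))" "\<And>x. G x analytic_on UNIV"
    "\<And>x t. G x (complex_of_real t) = complex_of_real (g (set_coord i t x))"
    using componentwise_entireE[OF assms(2)] by metis
  show "\<exists>H. continuous_on UNIV (\<lambda>p. H (fst p) (snd p)) \<and> (\<forall>x. H x analytic_on UNIV) \<and>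
      (\<forall>x t. H x (complex_of_real t) =
        complex_of_real (f (set_coord i t x) + g (set_coord i t x)))"
    by (rule exI[of _ "\<lambda>x z. F x z + G x z"])
      (auto simp: F(3) G(3) intro!: continuous_intros analytic_intros F(1,2) G(1,2))
qed

lemma componentwise_entire_mult [componentwise_entire_intros]:
  assumes "componentwise_entire f" "componentwise_entire g"
  shows "componentwise_entire (\<lambda>\<eta>. f \<eta> * g \<eta>)"
proof (rule componentwise_entireI)
  fix i
  obtain F where F: "continuous_on UNIV (\<lambda>p. F (fst p) (snd p))" "\<And>x. F x analytic_on UNIV"
    "\<And>x t. F x (complex_of_real t) = complex_of_real (f (set_coord i t x))"
    using componentwise_entireE[OF assms(1)] by metis
  obtain G where G: "continuous_on UNIV (\<lambda>p. G (fst p) (snd p))" "\<And>x. G x analytic_on UNIV"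
    "\<And>x t. G x (complex_of_real t) = complex_of_real (g (set_coord i t x))"
    using componentwise_entireE[OF assms(2)] by metis
  show "\<exists>H. continuous_on UNIV (\<lambda>p. H (fst p) (snd p)) \<and> (\<forall>x. H x analytic_on UNIV) \<and>
      (\<forall>x t. H x (complex_of_real t) =
        complex_of_real (f (set_coord i t x) * g (set_coord i t x)))"
    by (rule exI[of _ "\<lambda>x z. F x z * G x z"])
      (auto simp: F(3) G(3) intro!: continuous_intros analytic_intros F(1,2) G(1,2))
qed

lemma componentwise_entire_minus [componentwise_entire_intros]:
  "componentwise_entire f \<Longrightarrow> componentwise_entire (\<lambda>\<eta>. - f \<eta>)"
  using componentwise_entire_mult[OF componentwise_entire_const[of "- 1"]] by fastforce

lemma componentwise_entire_diff [componentwise_entire_intros]: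
  "componentwise_entire f \<Longrightarrow> componentwise_entire g \<Longrightarrow> componentwise_entire (\<lambda>\<eta>. f \<eta> - g \<eta>)"
  using componentwise_entire_add[OF _ componentwise_entire_minus] by fastforce

lemma componentwise_entire_power [componentwise_entire_intros]:
  "componentwise_entire f \<Longrightarrow> componentwise_entire (\<lambda>\<eta>. f \<eta> ^ n)"
  by (induction n) (auto intro: componentwise_entire_intros)

section \<open>Componentwise analytic functions\<close>

lemma componentwise_analytic_iff:
  "componentwise_analytic f \<longleftrightarrow>
     (\<forall>i. \<exists>\<rho> > 1/2. \<forall>x \<in> unit_cube. \<exists>g. g analytic_on closed_ellipse \<rho> \<and>
        (\<forall>t \<in> {0..1}. g (complex_of_real t) = f (set_coord i t x)))"
  by (simp add: componentwise_analytic_def set_coord_def)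

lemma unit_cube_eq_cbox: "unit_cube = cbox 0 (1 :: real ^ 'k)"
  by (auto simp: unit_cube_def mem_box_cart)

lemma set_coord_in_unit_cube:
  "x \<in> unit_cube \<Longrightarrow> t \<in> {0..1} \<Longrightarrow> set_coord i t x \<in> unit_cube"
  by (auto simp: unit_cube_def set_coord_def)

lemma closed_ellipse_mono:
  assumes "1 / 2 < \<rho>" "\<rho> \<le> \<sigma>"
  shows "closed_ellipse \<rho> \<subseteq> closed_ellipse \<sigma>"
proof -
  have "1 * 1 \<le> (2 * \<rho>) * (2 * \<sigma>)"
    using assms by (intro mult_mono) auto
  \<comment> \<open>The two bounds on the sum of distances differ by \<open>(\<sigma> - \<rho>) * (4
    * \<rho> * \<sigma> - 1) / (4 * \<rho> * \<sigma>)\<close>.\<close>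
  then have "0 \<le> (\<sigma> - \<rho>) * (4 * \<rho> * \<sigma> - 1)"
    using assms by simp
  then have "\<rho> + 1 / (4 * \<rho>) \<le> \<sigma> + 1 / (4 * \<sigma>)"
    using assms by (simp add: field_simps)
  then show ?thesis
    by (auto simp: closed_ellipse_def)
qed

text \<open>For \<open>\<rho> = 1/2\<close> the ellipse degenerates to its focal segment: the foci
  have distance 1, so the triangle inequality through \<open>z\<close> is an equality.\<close>

lemma dist_0_1_sum_eq_1:
  assumes "cmod z + cmod (z - 1) \<le> 1"
  shows "\<exists>t \<in> {0..1}. z = complex_of_real t"
proof -
  have "dist 0 (1 :: complex) = dist 0 z + dist z 1"
    using assms dist_triangle[of 0 "1 :: complex" z] by (simp add: dist_norm norm_minus_commute[of 1 z])
  then have "between (0, 1) z"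
    by (simp add: between)
  then obtain u where "0 \<le> u" "u \<le> 1" "z = (1 - u) *\<^sub>R 0 + u *\<^sub>R 1"
    by (auto simp: between_mem_segment in_segment)
  then show ?thesis
    by (intro bexI[of _ u]) (auto simp: scaleR_conv_of_real)
qed

text \<open>The ellipses shrink to the segment as \<open>\<rho>\<close> decreases to 1/2. The pairs
  violating positivity near the segment form a compact set, which misses the segment, so on it the
  sum of distances to the foci is bounded away from 1. An ellipse below that bound works for all
  parameters in \<open>K\<close>.\<close>

lemma closed_ellipse_positivity:
  fixes F :: "'a :: metric_space \<Rightarrow> complex \<Rightarrow> real"
  assumes cont: "continuous_on UNIV (\<lambda>p. F (fst p) (snd p))" and "compact K"
    and pos: "\<And>x t. x \<in> K \<Longrightarrow> t \<in> {0..1} \<Longrightarrow> 0 < F x (complex_of_real t)"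
  shows "\<exists>\<rho> > 1/2. \<forall>x \<in> K. \<forall>z \<in> closed_ellipse \<rho>. 0 < F x z"
proof -
  define e where "e z = cmod z + cmod (z - 1)" for z
  \<comment> \<open>The bad pairs with distance sum at most 2, where 2 is just a number above 1. The
    ball provides compactness and excludes nothing, as \<open>cmod z \<le> e z\<close>.\<close>
  define A where "A = (K \<times> cball 0 2) \<inter> ({p. F (fst p) (snd p) \<le> 0} \<inter> {p. e (snd p) \<le> 2})"
  have e: "\<exists>\<rho> > 1/2. \<forall>z \<in> closed_ellipse \<rho>. e z < m" if "1 < m" for m
  proof -
    define \<rho> where "\<rho> = 1 / 2 + min 1 ((m - 1) / 2)"
    have \<rho>: "1 / 2 < \<rho>"
      using that by (simp add: \<rho>_def)
    \<comment> \<open>Here \<open>1 / (4 * \<rho>) \<le> 1/2\<close>, so the bound exceeds 1 by at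
      most \<open>\<rho> - 1/2\<close>, which is at most half of \<open>m - 1\<close>.\<close>
    have "\<rho> + 1 / (4 * \<rho>) \<le> 1 + (\<rho> - 1 / 2)"
      using \<rho> by (simp add: field_simps)
    also have "\<dots> < m"
      using that by (simp add: \<rho>_def min_def field_simps)
    finally show ?thesis
      using \<rho> by (intro exI[of _ \<rho>]) (auto simp: closed_ellipse_def e_def)
  qed
  have cont_e: "continuous_on S (\<lambda>p. e (snd p))" for S :: "('a \<times> complex) set"
    unfolding e_def by (intro continuous_intros)
  have "compact A"
    unfolding A_def
    by (intro compact_Int_closed compact_Times \<open>compact K\<close> compact_cball closed_Int
        closed_Collect_le cont cont_e continuous_on_const)
  have "\<exists>m > 1. m \<le> 2 \<and> (\<forall>p \<in> A. m \<le> e (snd p))"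
  proof (cases "A = {}")
    case True
    then show ?thesis
      by (intro exI[of _ 2]) auto
  next
    case False
    then obtain p where p: "p \<in> A" "\<And>q. q \<in> A \<Longrightarrow> e (snd p) \<le> e (snd q)"
      using continuous_attains_inf[OF \<open>compact A\<close> False cont_e] by blast
    have "1 < e (snd p)"
    proof (rule ccontr)
      assume "\<not> 1 < e (snd p)"
      then obtain t where "t \<in> {0..1}" "snd p = complex_of_real t"
        using dist_0_1_sum_eq_1[of "snd p"] by (auto simp: e_def)
      then have "0 < F (fst p) (snd p)"
        using pos[of "fst p" t] p(1) by (auto simp: A_def)
      then show False
        using p(1) by (simp add: A_def)
    qed
    then show ?thesis
      using p by (intro exI[of _ "e (snd p)"]) (auto simp: A_def)
  qed
  then obtain m where m: "1 < m" "m \<le> 2" "\<And>p. p \<in> A \<Longrightarrow> m \<le> e (snd p)"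
    by blast
  obtain \<rho> where \<rho>: "1 / 2 < \<rho>" "\<And>z. z \<in> closed_ellipse \<rho> \<Longrightarrow> e z < m"
    using e[OF m(1)] by blast
  have "0 < F x z" if "x \<in> K" "z \<in> closed_ellipse \<rho>" for x z
  proof (rule ccontr)
    assume "\<not> 0 < F x z"
    moreover have "e z < m"
      using \<rho>(2) that(2) .
    moreover have "cmod z \<le> e z"
      by (simp add: e_def)
    ultimately have "(x, z) \<in> A"
      using that(1) m(2) by (simp add: A_def)
    then show False
      using m(3)[of "(x, z)"] \<open>e z < m\<close> by simp
  qed
  then show ?thesis
    using \<rho>(1) by blast
qed

text \<open>Positivity of \<open>q\<close> on the cube passes to the real part of its complex
  extension on a uniform ellipse. There the extension avoids the branch cut
  \<open>\<real>\<^sub>\<le>\<^sub>0\<close> of the power.\<close>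

lemma componentwise_analytic_mult_powr:
  assumes n: "componentwise_entire n" and q: "componentwise_entire q"
    and pos: "\<And>\<eta>. \<eta> \<in> unit_cube \<Longrightarrow> 0 < q \<eta>"
  shows "componentwise_analytic (\<lambda>\<eta>. complex_of_real (n \<eta> * q \<eta> powr a))"
  unfolding componentwise_analytic_iff
proof
  fix i
  obtain P where P: "\<And>x. P x analytic_on UNIV"
    "\<And>x t. P x (complex_of_real t) = complex_of_real (n (set_coord i t x))"
    using componentwise_entireE[OF n] by metis
  obtain Q where Q: "continuous_on UNIV (\<lambda>p. Q (fst p) (snd p))" "\<And>x. Q x analytic_on UNIV"
    "\<And>x t. Q x (complex_of_real t) = complex_of_real (q (set_coord i t x))"
    using componentwise_entireE[OF q] by metis
  have "\<exists>\<rho> > 1/2. \<forall>x \<in> unit_cube. \<forall>z \<in> closed_ellipse \<rho>. 0 < Re (Q x z)"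
    using pos set_coord_in_unit_cube
    by (intro closed_ellipse_positivity continuous_intros Q(1))
      (auto simp: Q(3) unit_cube_eq_cbox)
  then obtain \<rho> where \<rho>: "1 / 2 < \<rho>"
    "\<And>x z. x \<in> unit_cube \<Longrightarrow> z \<in> closed_ellipse \<rho> \<Longrightarrow> 0 < Re (Q x z)"
    by blast
  have "\<exists>g. g analytic_on closed_ellipse \<rho> \<and> (\<forall>t\<in>{0..1}. g (complex_of_real t) =
      complex_of_real (n (set_coord i t x) * q (set_coord i t x) powr a))"
    if x: "x \<in> unit_cube" for x
  proof (intro exI conjI ballI)
    show "(\<lambda>z. P x z * Q x z powr complex_of_real a) analytic_on closed_ellipse \<rho>"
    proof (intro analytic_intros)
      show "P x analytic_on closed_ellipse \<rho>" "Q x analytic_on closed_ellipse \<rho>"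
        using P(1) Q(2) analytic_on_subset by blast+
      show "Q x z \<notin> \<real>\<^sub>\<le>\<^sub>0" if "z \<in> closed_ellipse \<rho>" for z
        using \<rho>(2)[OF x that] by (auto simp: complex_nonpos_Reals_iff)
    qed
    fix t :: real
    assume "t \<in> {0..1}"
    \<comment> \<open>The complex power restricts to the real one at nonnegative bases, as
      \<open>powr_of_real\<close> demands.\<close>
    then have "0 < q (set_coord i t x)"
      using pos set_coord_in_unit_cube x by blast
    then show "P x t * Q x t powr a =
        complex_of_real (n (set_coord i t x) * q (set_coord i t x) powr a)"
      by (simp add: P(2) Q(3) powr_of_real)
  qed
  then show "\<exists>\<rho> > 1/2. \<forall>x \<in> unit_cube. \<exists>g. g analytic_on closed_ellipse \<rho> \<and>
      (\<forall>t\<in>{0..1}. g (complex_of_real t) =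
        complex_of_real (n (set_coord i t x) * q (set_coord i t x) powr a))"
    using \<rho>(1) by blast
qed

lemma componentwise_analytic_add:
  assumes "componentwise_analytic f" "componentwise_analytic g"
  shows "componentwise_analytic (\<lambda>\<eta>. f \<eta> + g \<eta>)"
  unfolding componentwise_analytic_iff
proof
  fix i
  obtain \<rho> where \<rho>: "1 / 2 < \<rho>" "\<And>x. x \<in> unit_cube \<Longrightarrow> \<exists>h. h analytic_on closed_ellipse \<rho> \<and>
      (\<forall>t\<in>{0..1}. h (complex_of_real t) = f (set_coord i t x))"
    using assms(1) unfolding componentwise_analytic_iff by meson
  obtain \<sigma> where \<sigma>: "1 / 2 < \<sigma>" "\<And>x. x \<in> unit_cube \<Longrightarrow> \<exists>h. h analytic_on closed_ellipse \<sigma> \<and>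
      (\<forall>t\<in>{0..1}. h (complex_of_real t) = g (set_coord i t x))"
    using assms(2) unfolding componentwise_analytic_iff by meson
  \<comment> \<open>The summands come with different ellipses; the smaller one lies in both.\<close>
  define \<tau> where "\<tau> = min \<rho> \<sigma>"
  have sub: "closed_ellipse \<tau> \<subseteq> closed_ellipse \<rho>" "closed_ellipse \<tau> \<subseteq> closed_ellipse \<sigma>"
    using \<rho>(1) \<sigma>(1) by (auto simp: \<tau>_def intro!: closed_ellipse_mono del: subsetI)
  have "\<exists>h. h analytic_on closed_ellipse \<tau> \<and>
      (\<forall>t\<in>{0..1}. h (complex_of_real t) = f (set_coord i t x) + g (set_coord i t x))"
    if "x \<in> unit_cube" for x
  proof -
    from \<rho>(2)[OF that] obtain F where "F analytic_on closed_ellipse \<rho>"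
      "\<forall>t\<in>{0..1}. F (complex_of_real t) = f (set_coord i t x)"
      by blast
    moreover from \<sigma>(2)[OF that] obtain G where "G analytic_on closed_ellipse \<sigma>"
      "\<forall>t\<in>{0..1}. G (complex_of_real t) = g (set_coord i t x)"
      by blast
    ultimately show ?thesis
      using sub by (intro exI[of _ "\<lambda>z. F z + G z"])
        (auto intro!: analytic_intros elim: analytic_on_subset)
  qed
  then show "\<exists>\<rho> > 1/2. \<forall>x \<in> unit_cube. \<exists>h. h analytic_on closed_ellipse \<rho> \<and>
      (\<forall>t\<in>{0..1}. h (complex_of_real t) = f (set_coord i t x) + g (set_coord i t x))"
    using \<rho>(1) \<sigma>(1) by (intro exI[of _ \<tau>]) (auto simp: \<tau>_def)
qed

lemma componentwise_analytic_zero: "componentwise_analytic (\<lambda>\<eta>. 0)"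
  unfolding componentwise_analytic_iff
  by (intro allI exI[of _ 1] conjI ballI exI[of _ "\<lambda>z. 0"]) auto

lemma componentwise_analytic_regularized:
  assumes "\<And>D J. (D, J) \<in> set Ds \<Longrightarrow>
    componentwise_analytic (\<lambda>\<eta>. complex_of_real (k (D \<eta>) * J \<eta>))"
  shows "componentwise_analytic (\<lambda>\<eta>. complex_of_real (regularized Ds k \<eta>))"
  using assms
proof (induction Ds)
  case Nil
  then show ?case
    by (simp add: regularized_def componentwise_analytic_zero)
next
  case (Cons a Ds)
  obtain D J where a: "a = (D, J)"
    by fastforce
  have "componentwise_analytic
      (\<lambda>\<eta>. complex_of_real (k (D \<eta>) * J \<eta>) + complex_of_real (regularized Ds k \<eta>))"
    using Cons by (intro componentwise_analytic_add) (auto simp: a)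
  then show ?case
    by (simp add: regularized_def a)
qed

section \<open>Pairs of tetrahedra with a common face\<close>

text \<open>Weights on \<open>S\<close> may be negative. Adding the same large weight at each vertex
  of \<open>S\<close> on both sides and rescaling moves the common point into both hulls, hence into
  the hull of \<open>S\<close>. Affine independence of \<open>C\<close> then leaves no weight
  outside \<open>S\<close>.\<close>

lemma affine_combination_common_face:
  fixes u u' :: "'a :: euclidean_space \<Rightarrow> real"
  assumes aff: "\<not> affine_dependent C" "\<not> affine_dependent C'"
    and S: "S \<subseteq> C" "S \<subseteq> C'" "S \<noteq> {}"
    and hull: "convex hull C \<inter> convex hull C' \<subseteq> convex hull S"
    and sum: "sum u C = 1" "sum u' C' = 1"
    and nonneg: "\<And>v. v \<in> C - S \<Longrightarrow> 0 \<le> u v" "\<And>v. v \<in> C' - S \<Longrightarrow> 0 \<le> u' v"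
    and eq: "(\<Sum>v\<in>C. u v *\<^sub>R v) = (\<Sum>v\<in>C'. u' v *\<^sub>R v)"
  shows "\<forall>v \<in> C - S. u v = 0"
proof -
  have fin: "finite C" "finite C'"
    using aff aff_independent_finite by blast+
  then have "finite S"
    using S finite_subset by blast
  \<comment> \<open>One bound for both families of weights, so that the same shift repairs the signs
    on both sides.\<close>
  define B where "B = (\<Sum>v\<in>S. \<bar>u v\<bar> + \<bar>u' v\<bar>)"
  have B: "\<bar>u v\<bar> \<le> B \<and> \<bar>u' v\<bar> \<le> B" if "v \<in> S" for v
    using member_le_sum[OF that, of "\<lambda>v. \<bar>u v\<bar> + \<bar>u' v\<bar>"] \<open>finite S\<close> by (auto simp: B_def)
  have "0 \<le> B"
    by (auto simp: B_def intro: sum_nonneg)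
  \<comment> \<open>The total weight after adding \<open>B\<close> at each vertex of
    \<open>S\<close>; dividing by it restores sum 1.\<close>
  define d where "d = 1 + card S * B"
  have "0 < d"
    using \<open>0 \<le> B\<close> by (simp add: d_def add_pos_nonneg)
  \<comment> \<open>Moving towards the barycentre of the common face makes the weights at its vertices
    nonnegative as well.\<close>
  define w where "w f v = (f v + (if v \<in> S then B else 0)) / d" for f :: "'a \<Rightarrow> real" and v
  have sum_w: "sum (w f) D = 1" if "finite D" "S \<subseteq> D" "sum f D = 1" for f D
  proof -
    have "sum (w f) D = (sum f D + (\<Sum>v\<in>D. if v \<in> S then B else 0)) / d"
      by (simp add: w_def sum_divide_distrib[symmetric] sum.distrib)
    also have "(\<Sum>v\<in>D. if v \<in> S then B else 0) = card S * B"
      using that by (simp add: sum.If_cases Int_absorb1)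
    finally show ?thesis
      using that \<open>0 < d\<close> by (simp add: d_def)
  qed
  have pt_w: "(\<Sum>v\<in>D. w f v *\<^sub>R v) = (1 / d) *\<^sub>R ((\<Sum>v\<in>D. f v *\<^sub>R v) + (\<Sum>v\<in>S. B *\<^sub>R v))"
    if "finite D" "S \<subseteq> D" for f D
  proof -
    have "(\<Sum>v\<in>D. w f v *\<^sub>R v) =
        (\<Sum>v\<in>D. (1 / d) *\<^sub>R (f v *\<^sub>R v + (if v \<in> S then B *\<^sub>R v else 0)))"
      by (intro sum.cong) (auto simp: w_def add_divide_distrib scaleR_add_left scaleR_add_right)
    also have "\<dots> = (1 / d) *\<^sub>R
        ((\<Sum>v\<in>D. f v *\<^sub>R v) + (\<Sum>v\<in>D. if v \<in> S then B *\<^sub>R v else 0))"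
      by (simp add: scaleR_sum_right[symmetric] sum.distrib)
    also have "(\<Sum>v\<in>D. if v \<in> S then B *\<^sub>R v else 0) = (\<Sum>v\<in>S. B *\<^sub>R v)"
      using that by (simp add: sum.If_cases Int_absorb1)
    finally show ?thesis .
  qed
  define z where "z = (\<Sum>v\<in>C. w u v *\<^sub>R v)"
  have z': "z = (\<Sum>v\<in>C'. w u' v *\<^sub>R v)"
    using pt_w[OF fin(1) S(1)] pt_w[OF fin(2) S(2)] eq by (simp add: z_def)
  have "0 \<le> w u v" if "v \<in> C" for v
    using B[of v] nonneg(1)[of v] that \<open>0 < d\<close> by (cases "v \<in> S") (auto simp: w_def)
  then have zC: "z \<in> convex hull C"
    using sum_w[OF fin(1) S(1) sum(1)] by (auto simp: convex_hull_finite fin z_def)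
  have "0 \<le> w u' v" if "v \<in> C'" for v
    using B[of v] nonneg(2)[of v] that \<open>0 < d\<close> by (cases "v \<in> S") (auto simp: w_def)
  then have "z \<in> convex hull C'"
    using sum_w[OF fin(2) S(2) sum(2)] by (auto simp: convex_hull_finite fin z')
  with zC hull have "z \<in> convex hull S"
    by blast
  then obtain r where r: "sum r S = 1" "(\<Sum>v\<in>S. r v *\<^sub>R v) = z"
    by (auto simp: convex_hull_finite \<open>finite S\<close>)
  \<comment> \<open>The difference of two affine representations of \<open>z\<close> over
    \<open>C\<close>, with \<open>r\<close> extended by 0. Outside \<open>S\<close> it equals
    \<open>u v / d\<close>.\<close>
  define U where "U v = w u v - (if v \<in> S then r v else 0)" for v
  have "sum U C = 0"
    using sum_w[OF fin(1) S(1) sum(1)] r(1) fin(1) S(1)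
    by (simp add: U_def sum_subtractf sum.If_cases Int_absorb1)
  moreover have "(\<Sum>v\<in>C. U v *\<^sub>R v) = 0"
  proof -
    have "(\<Sum>v\<in>C. U v *\<^sub>R v) = (\<Sum>v\<in>C. w u v *\<^sub>R v - (if v \<in> S then r v *\<^sub>R v else 0))"
      by (intro sum.cong) (auto simp: U_def algebra_simps)
    also have "\<dots> = 0"
      using r(2) fin(1) S(1) by (simp add: sum_subtractf sum.If_cases Int_absorb1 z_def)
    finally show ?thesis .
  qed
  ultimately have "\<forall>v \<in> C. U v = 0"
    using aff(1) fin(1) by (auto simp: affine_dependent_explicit_finite)
  then show ?thesis
    using \<open>0 < d\<close> by (force simp: U_def w_def)
qed

text \<open>The previous lemma, applied in both directions, reduces both combinations to
  \<open>S\<close>, where affine independence makes the weights unique.\<close>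

lemma affine_combination_common_face_eq:
  fixes u u' :: "'a :: euclidean_space \<Rightarrow> real"
  assumes "\<not> affine_dependent C" "\<not> affine_dependent C'" "S \<subseteq> C" "S \<subseteq> C'" "S \<noteq> {}"
    and "convex hull C \<inter> convex hull C' \<subseteq> convex hull S"
    and "sum u C = 1" "sum u' C' = 1"
    and "\<And>v. v \<in> C - S \<Longrightarrow> 0 \<le> u v" "\<And>v. v \<in> C' - S \<Longrightarrow> 0 \<le> u' v"
    and eq: "(\<Sum>v\<in>C. u v *\<^sub>R v) = (\<Sum>v\<in>C'. u' v *\<^sub>R v)"
  shows "\<forall>v \<in> C - S. u v = 0" "\<forall>v \<in> C' - S. u' v = 0" "\<forall>v \<in> S. u v = u' v"
proof -
  show u: "\<forall>v \<in> C - S. u v = 0"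
    using affine_combination_common_face[OF assms] by blast
  show u': "\<forall>v \<in> C' - S. u' v = 0"
    using affine_combination_common_face[of C' C S u' u] assms by (auto simp: Int_commute)
  have fin: "finite C" "finite C'"
    using assms(1,2) aff_independent_finite by blast+
  have red: "sum u C = sum u S" "sum u' C' = sum u' S"
    "(\<Sum>v\<in>C. u v *\<^sub>R v) = (\<Sum>v\<in>S. u v *\<^sub>R v)" "(\<Sum>v\<in>C'. u' v *\<^sub>R v) = (\<Sum>v\<in>S. u' v *\<^sub>R v)"
    using fin assms(3,4) u u' by (auto intro!: sum.mono_neutral_right)
  have "\<not> affine_dependent S"
    using assms(1,3) affine_dependent_subset by blast
  moreover have "(\<Sum>v\<in>S. u v - u' v) = 0" "(\<Sum>v\<in>S. (u v - u' v) *\<^sub>R v) = 0"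
    using red eq assms(7,8) by (simp_all add: sum_subtractf scaleR_diff_left)
  ultimately have "\<forall>v \<in> S. u v - u' v = 0"
    using affine_dependent_explicit_finite[OF finite_subset[OF assms(3) fin(1)]] by blast
  then show "\<forall>v \<in> S. u v = u' v"
    by simp
qed

text \<open>The barycentric coordinates of the image of \<open>x\<close> with respect to the ordered
  vertices, read off from the columns \<open>b - a\<close>, \<open>c - b\<close>,
  \<open>d - b\<close>. All four are nonnegative exactly on the reference tetrahedron.\<close>

definition ref_weights :: "real ^ 3 \<Rightarrow> real list" where
  "ref_weights x = [1 - x $ 1, x $ 1 - x $ 2 - x $ 3, x $ 2, x $ 3]"

lemma ref_map_nth:
  "ref_map p x $ l = (p ! 1 - p ! 0) $ l * x $ 1 + (p ! 2 - p ! 1) $ l * x $ 2 +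
     (p ! 3 - p ! 1) $ l * x $ 3 + p ! 0 $ l"
  by (simp add: ref_map_def ref_matrix_def matrix_vector_mult_def transpose_def sum_3)

lemma ref_map_eq_sum: "ref_map p x = (\<Sum>m<4. ref_weights x ! m *\<^sub>R p ! m)"
  by (simp add: vec_eq_iff ref_map_nth ref_weights_def eval_nat_numeral algebra_simps)

lemma vertices_simplex:
  assumes "3 simplex t"
  shows "\<not> affine_dependent (vertices t)" "card (vertices t) = 4" "t = convex hull (vertices t)"
proof -
  obtain C where C: "\<not> affine_dependent C" "int (card C) = 3 + 1" "t = convex hull C"
    using assms unfolding simplex_def by blast
  then have "vertices t = C"
    by (auto simp: vertices_def extreme_point_of_convex_hull_affine_independent)
  with C show "\<not> affine_dependent (vertices t)" "card (vertices t) = 4" "t = convex hull (vertices t)"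
    by auto
qed

text \<open>Passes from weights indexed by list positions to weights indexed by vertices, the form
  in which affine independence is stated.\<close>

lemma vertex_ordering_weights:
  assumes "3 simplex t" "vertex_ordering t p"
  shows "\<exists>u. (\<forall>m<4. u (p ! m) = ref_weights x ! m) \<and> sum u (vertices t) = 1 \<and>
    (\<Sum>v\<in>vertices t. u v *\<^sub>R v) = ref_map p x"
proof -
  have p: "distinct p" "set p = vertices t"
    using assms by (auto simp: vertex_ordering_def)
  then have len: "length p = 4"
    using vertices_simplex(2)[OF assms(1)] distinct_card by metis
  \<comment> \<open>As the vertices in \<open>p\<close> are distinct, just one summand survives at
    each vertex.\<close>
  define u where "u v = (\<Sum>m<4. if p ! m = v then ref_weights x ! m else 0)" for v
  have u: "u (p ! m) = ref_weights x ! m" if "m < 4" for m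
  proof -
    have "u (p ! m) = (\<Sum>m'<4. if m' = m then ref_weights x ! m' else 0)"
      unfolding u_def using that p(1) len by (intro sum.cong) (auto simp: nth_eq_iff_index_eq)
    then show ?thesis
      using that by simp
  qed
  have bij: "bij_betw ((!) p) {..<4} (vertices t)"
    using bij_betw_nth[OF p(1), of "{..<4}"] p(2) len by auto
  show ?thesis
  proof (intro exI conjI allI impI)
    show "u (p ! m) = ref_weights x ! m" if "m < 4" for m
      using u that .
    have "sum u (vertices t) = (\<Sum>m<4. ref_weights x ! m)"
      unfolding sum.reindex_bij_betw[OF bij, symmetric] by (simp add: u)
    then show "sum u (vertices t) = 1"
      by (simp add: ref_weights_def eval_nat_numeral)
    show "(\<Sum>v\<in>vertices t. u v *\<^sub>R v) = ref_map p x"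
      unfolding sum.reindex_bij_betw[OF bij, symmetric] ref_map_eq_sum by (simp add: u)
  qed
qed

text \<open>Coordinates of \<open>x\<close> and \<open>y\<close> belonging to common vertices carry no sign condition, so \<open>x\<close> and
  \<open>y\<close> may lie outside the reference tetrahedron, as the points of the transformations do.\<close>

lemma ref_map_eq_imp:
  assumes "3 simplex t1" "3 simplex t2" "common_vertices_first k t1 t2 p1 p2" "0 < k" "k \<le> 4"
    and nonneg: "\<forall>w \<in> set (drop k (ref_weights x)) \<union> set (drop k (ref_weights y)). 0 \<le> w"
    and "ref_map p1 x = ref_map p2 y"
  shows "x = y \<and> (\<forall>w \<in> set (drop k (ref_weights x)). w = 0)"
proof -
  have ord: "vertex_ordering t1 p1" "vertex_ordering t2 p2" and tk: "take k p1 = take k p2"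
    and int: "t1 \<inter> t2 = convex hull (set (take k p1))"
    using assms(3) by (auto simp: common_vertices_first_def)
  have p: "distinct p1" "distinct p2" "set p1 = vertices t1" "set p2 = vertices t2"
    using ord by (auto simp: vertex_ordering_def)
  then have len: "length p1 = 4" "length p2 = 4"
    using vertices_simplex(2) assms(1,2) distinct_card by metis+
  have lw: "length (ref_weights v) = 4" for v
    by (simp add: ref_weights_def)
  obtain u where u: "\<And>m. m < 4 \<Longrightarrow> u (p1 ! m) = ref_weights x ! m" "sum u (vertices t1) = 1"
    "(\<Sum>v\<in>vertices t1. u v *\<^sub>R v) = ref_map p1 x"
    using vertex_ordering_weights[OF assms(1) ord(1), of x] by blast
  obtain u' where u': "\<And>m. m < 4 \<Longrightarrow> u' (p2 ! m) = ref_weights y ! m" "sum u' (vertices t2) = 1"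
    "(\<Sum>v\<in>vertices t2. u' v *\<^sub>R v) = ref_map p2 y"
    using vertex_ordering_weights[OF assms(2) ord(2), of y] by blast
  define S where "S = set (take k p1)"
  have S': "S = set (take k p2)"
    by (simp add: S_def tk)
  \<comment> \<open>Vertices outside \<open>S\<close> sit at positions from \<open>k\<close> on,
    which is where the sign condition on the weights is available.\<close>
  have diff: "\<exists>m. k \<le> m \<and> m < 4 \<and> v = p ! m"
    if "length p = 4" "v \<in> set p - set (take k p)" for p :: "(real ^ 3) list" and v
  proof -
    have "v \<in> set p"
      using that(2) by simp
    then obtain m where "m < length p" "p ! m = v"
      unfolding in_set_conv_nth by blast
    then have m: "m < 4" "v = p ! m"
      using that(1) by simp_all
    have "k \<le> m"
    proof (rule ccontr)
      assume "\<not> k \<le> m"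
      then have "v \<in> set (take k p)"
        using m that(1) by (auto simp: in_set_conv_nth intro!: exI[of _ m])
      then show False
        using that(2) by blast
    qed
    with m show ?thesis
      by blast
  qed
  have drop_mem: "ref_weights v ! m \<in> set (drop k (ref_weights v))" if "k \<le> m" "m < 4" for m v
    using nth_mem[of "m - k" "drop k (ref_weights v)"] that by (simp add: lw)
  have not_S: "p ! m \<in> set p - set (take k p)"
    if "length p = 4" "distinct p" "k \<le> m" "m < 4" for p :: "(real ^ 3) list" and m
    using that by (auto simp: in_set_conv_nth nth_eq_iff_index_eq)
  have aff: "\<not> affine_dependent (vertices t1)" "\<not> affine_dependent (vertices t2)"
    using vertices_simplex(1) assms(1,2) by blast+
  have sub1: "S \<subseteq> vertices t1"
    using set_take_subset[of k p1] by (simp add: S_def p)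
  have sub2: "S \<subseteq> vertices t2"
    using set_take_subset[of k p2] by (simp add: S' p)
  have ne: "S \<noteq> {}"
    using \<open>0 < k\<close> len(1) by (auto simp: S_def)
  have hull: "convex hull (vertices t1) \<inter> convex hull (vertices t2) \<subseteq> convex hull S"
    using int vertices_simplex(3)[OF assms(1)] vertices_simplex(3)[OF assms(2)]
    by (simp add: S_def)
  have nonneg1: "0 \<le> u v" if "v \<in> vertices t1 - S" for v
    using diff[OF len(1), of v] that u(1) nonneg drop_mem by (auto simp: S_def p)
  have nonneg2: "0 \<le> u' v" if "v \<in> vertices t2 - S" for v
    using diff[OF len(2), of v] that u'(1) nonneg drop_mem by (auto simp: S' p)
  have "(\<Sum>v\<in>vertices t1. u v *\<^sub>R v) = (\<Sum>v\<in>vertices t2. u' v *\<^sub>R v)"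
    using u(3) u'(3) assms(7) by simp
  note main = affine_combination_common_face_eq[OF aff sub1 sub2 ne hull u(2) u'(2)
      nonneg1 nonneg2 this]
  have zero: "ref_weights x ! m = 0 \<and> ref_weights y ! m = 0" if "k \<le> m" "m < 4" for m
    using main(1,2) not_S[OF len(1) p(1) that] not_S[OF len(2) p(2) that] u(1) u'(1) that
    by (fastforce simp: S_def[symmetric] S'[symmetric] p)
  have common: "ref_weights x ! m = ref_weights y ! m" if "m < k" for m
  proof -
    have "p1 ! m = p2 ! m"
      using tk that by (metis nth_take)
    moreover have "p1 ! m \<in> S"
      using that \<open>k \<le> 4\<close> len(1) by (auto simp: S_def in_set_conv_nth)
    ultimately show ?thesis
      using main(3) u(1)[of m] u'(1)[of m] that \<open>k \<le> 4\<close> by auto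
  qed
  have "ref_weights x = ref_weights y"
    using zero common by (metis lw not_less nth_equalityI)
  \<comment> \<open>The last two weights are \<open>x $ 2\<close> and \<open>x $ 3\<close>, and the
    first one is \<open>1 - x $ 1\<close>, so the weights determine the point.\<close>
  then have "x = y"
    by (auto simp: ref_weights_def vec_eq_iff forall_3)
  moreover have "\<forall>w \<in> set (drop k (ref_weights x)). w = 0"
    using zero lw by (force simp: in_set_conv_nth)
  ultimately show ?thesis
    by blast
qed

text \<open>Makes the definite description in \<open>affine_ext\<close> meaningful: two distinct
  affine functions agree at most on a plane, which cannot contain a tetrahedron.\<close>

lemma affine_ext_affine_fun:
  assumes "3 simplex t" "affine_fun f" "\<And>x. x \<in> t \<Longrightarrow> \<psi> x = f x"
  shows "affine_fun (affine_ext \<psi> t)"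
proof -
  have "g = f" if g: "affine_fun g" "\<forall>x\<in>t. g x = \<psi> x" for g
  proof -
    obtain a b where f: "\<And>x. f x = a \<bullet> x + b"
      using assms(2) unfolding affine_fun_def by blast
    obtain c d where gx: "\<And>x. g x = c \<bullet> x + d"
      using g(1) unfolding affine_fun_def by blast
    have sub: "t \<subseteq> {x. (a - c) \<bullet> x = d - b}"
      using g(2) assms(3) f gx by (fastforce simp: inner_diff_left)
    have "a = c"
    proof (rule ccontr)
      assume "a \<noteq> c"
      then have "aff_dim {x. (a - c) \<bullet> x = d - b} = 2"
        by (simp add: aff_dim_hyperplane)
      moreover have "aff_dim t = 3"
        using assms(1) aff_dim_simplex by blast
      ultimately show False
        using aff_dim_subset[OF sub] by simp
    qed
    moreover have "t \<noteq> {}"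
      using assms(1) by auto
    ultimately have "b = d"
      using sub by auto
    with \<open>a = c\<close> show "g = f"
      using f gx by auto
  qed
  then have "affine_ext \<psi> t = f"
    unfolding affine_ext_def using assms(2,3) by (intro the_equality) auto
  with assms(2) show ?thesis
    by simp
qed

text \<open>The sign hypothesis of \<open>ref_map_eq_imp\<close> together with the negation of its
  conclusion. It does not mention the tetrahedra, so it can be checked on the transformations
  alone.\<close>

definition separated :: "nat \<Rightarrow> (real ^ 3) \<times> (real ^ 3) \<Rightarrow> bool" where
  "separated k = (\<lambda>(x, y).
     (\<forall>w \<in> set (drop k (ref_weights x)) \<union> set (drop k (ref_weights y)). 0 \<le> w) \<and>
     \<not> (x = y \<and> (\<forall>w \<in> set (drop k (ref_weights x)). w = 0)))"

lemma separated_swap: "separated k (prod.swap p) \<longleftrightarrow> separated k p"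
  by (cases p) (auto simp: separated_def)

lemma kt_denom_nonzero:
  assumes "3 simplex t1" "3 simplex t2" "common_vertices_first k t1 t2 p1 p2" "0 < k" "k \<le> 4"
    and "separated k p"
  shows "kt_denom s p1 p2 p \<noteq> 0"
  using ref_map_eq_imp[OF assms(1-5)] assms(6)
  by (cases p) (auto simp: separated_def kt_denom_def)

lemma unit_cube_nth:
  assumes "\<eta> \<in> unit_cube"
  shows "0 \<le> \<eta> $ l" "\<eta> $ l \<le> 1"
  using assms by (auto simp: unit_cube_def)

section \<open>The regularizing transformations\<close>

lemma vec3_eq_iff: "vec3 a b c = vec3 a' b' c' \<longleftrightarrow> a = a' \<and> b = b' \<and> c = c'"
  by (auto simp: vec_eq_iff forall_3)

text \<open>The weights after the first one add up to the first coordinate, which is 1 at one of the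
  two points, so they cannot all vanish.\<close>

lemma separated_transf_V:
  assumes "\<eta> \<in> unit_cube"
  shows "\<forall>(D, J) \<in> set transf_V. separated 1 (D \<eta>)"
proof -
  have "separated 1 (vec3 1 (a * b) (a * (1 - b)), vec3 c (c * d * e) (c * d * (1 - e)))"
    if "0 \<le> a" "a \<le> 1" "0 \<le> b" "b \<le> 1" "0 \<le> c" "0 \<le> d" "d \<le> 1" "0 \<le> e" "e \<le> 1" for a b c d e
  proof -
    have "0 \<le> c * (1 - d)"
      using that by simp
    then have "a * b + a * (1 - b) \<le> 1" "c * d * e + c * d * (1 - e) \<le> c"
      using that by (simp_all add: algebra_simps)
    then show ?thesis
      using that by (auto simp: separated_def ref_weights_def vec3_eq_iff)
  qed
  then show ?thesis
    using unit_cube_nth[OF assms]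
    by (auto simp: transf_V_def Let_def transp_def separated_swap simp del: swap_simp)
qed

text \<open>The relevant weights are the last two coordinates. In the first pair those of the first
  point add up to 1. In the second pair those of the second point add up to
  \<open>1 - a * b\<close>, and coinciding points have \<open>a * b = 0\<close>.\<close>

lemma separated_transf_E:
  assumes "\<eta> \<in> unit_cube"
  shows "\<forall>(D, J) \<in> set transf_E. separated 2 (D \<eta>)"
proof -
  have "separated 2 (vec3 0 a (1 - a), vec3 (- (b * c * d)) (b * c * (1 - d)) (b * (1 - c)))"
    if "0 \<le> a" "a \<le> 1" "0 \<le> b" "b \<le> 1" "0 \<le> c" "c \<le> 1" "0 \<le> d" "d \<le> 1" for a b c d
    using that by (auto simp: separated_def ref_weights_def vec3_eq_iff)
  moreover have "separated 2 (vec3 0 (c * d) (c * (1 - d)), vec3 (- (a * b)) (a * (1 - b)) (1 - a))"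
    if "0 \<le> a" "a \<le> 1" "0 \<le> b" "b \<le> 1" "0 \<le> c" "c \<le> 1" "0 \<le> d" "d \<le> 1" for a b c d
    using that by (auto simp: separated_def ref_weights_def vec3_eq_iff)
  ultimately show ?thesis
    using unit_cube_nth[OF assms]
    by (auto simp: transf_E_def Let_def transp_def separated_swap simp del: swap_simp)
qed

text \<open>The only relevant weight is the third coordinate. In every pair one of the points has
  third coordinate 1, or 1 minus a product that vanishes once the first two coordinates agree. The
  bounds on products give nonnegativity.\<close>

lemma separated_transf_F:
  assumes "\<eta> \<in> unit_cube"
  shows "\<forall>(D, J) \<in> set transf_F. separated 3 (D \<eta>)"
proof -
  define a b c where "a = \<eta> $ 1" "b = \<eta> $ 2" "c = \<eta> $ 3"
  have bounds: "0 \<le> a" "a \<le> 1" "0 \<le> b" "b \<le> 1" "0 \<le> c" "c \<le> 1"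
    using unit_cube_nth[OF assms] by (auto simp: a_b_c_def)
  then have "a * b \<le> 1" "b * c \<le> 1" "a * b * c \<le> 1"
    by (auto intro: mult_le_one)
  with bounds show ?thesis
    by (simp add: transf_F_def Let_def transp_def separated_swap a_b_c_def[symmetric] del: swap_simp,
        intro conjI; simp add: separated_def ref_weights_def vec3_eq_iff; auto)
qed

text \<open>No weights remain after dropping four, so the claim is that the two points differ:
  equating their coordinates is contradictory for every \<open>\<eta>\<close>.\<close>

lemma separated_transf_T: "\<forall>(D, J) \<in> set transf_T. separated 4 (D \<eta>)"
  by (simp add: transf_T_def Let_def, intro conjI; simp add: separated_def ref_weights_def vec3_eq_iff; auto)

section \<open>Analyticity of the transformed kernel\<close>

definition componentwise_entire_transf :: "('k :: finite) transf \<Rightarrow> bool" where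
  "componentwise_entire_transf = (\<lambda>(D, J). componentwise_entire J \<and>
     (\<forall>l. componentwise_entire (\<lambda>\<eta>. fst (D \<eta>) $ l) \<and> componentwise_entire (\<lambda>\<eta>. snd (D \<eta>) $ l)))"

lemma componentwise_entire_transp:
  "componentwise_entire_transf (transp T) \<longleftrightarrow> componentwise_entire_transf T"
  by (cases T) (auto simp: transp_def componentwise_entire_transf_def)

lemma componentwise_entire_transfs:
  "\<forall>T \<in> set transf_V. componentwise_entire_transf T"
  "\<forall>T \<in> set transf_E. componentwise_entire_transf T"
  "\<forall>T \<in> set transf_F. componentwise_entire_transf T"
  "\<forall>T \<in> set transf_T. componentwise_entire_transf T"
  by (auto simp: transf_V_def transf_E_def transf_F_def transf_T_def Let_def
      componentwise_entire_transp)
    (auto simp: componentwise_entire_transf_def forall_3 intro!: componentwise_entire_intros)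

lemma componentwise_entire_affine_fun:
  fixes x :: "real ^ 'k \<Rightarrow> real ^ 3"
  assumes "affine_fun f" "\<And>l. componentwise_entire (\<lambda>\<eta>. x \<eta> $ l)"
  shows "componentwise_entire (\<lambda>\<eta>. f (x \<eta>))"
proof -
  obtain a b where "\<And>x. f x = a \<bullet> x + b"
    using assms(1) unfolding affine_fun_def by blast
  then show ?thesis
    by (simp add: inner_vec_def sum_3) (intro componentwise_entire_intros assms(2))
qed

lemma affine_fun_ref_map: "affine_fun (\<lambda>x. ref_map p x $ l)"
  unfolding affine_fun_def ref_map_def
  by (intro exI[of _ "ref_matrix p $ l"] exI[of _ "p ! 0 $ l"])
    (simp add: matrix_vector_mul_component)

text \<open>Moves the square root of the norm into the exponent, so that the base becomes polynomial
  in the coordinates.\<close>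

lemma norm_powr_eq: "norm v powr a = (v \<bullet> v) powr (a / 2)"
  by (simp add: norm_eq_sqrt_inner powr_half_sqrt[symmetric] powr_powr)

text \<open>Numerator, determinants and Jacobian weight are collected in \<open>n\<close>, and the
  squared distance of the image points is \<open>q\<close>; the nonzero denominator makes
  \<open>q\<close> positive on the cube.\<close>

lemma componentwise_analytic_kt:
  assumes "affine_fun (affine_ext \<psi> t1)" "affine_fun (affine_ext \<psi> t2)"
    and "affine_fun (affine_ext \<psi>' t1)" "affine_fun (affine_ext \<psi>' t2)"
    and "componentwise_entire_transf (D, J)"
    and nz: "\<And>\<eta>. \<eta> \<in> unit_cube \<Longrightarrow> kt_denom s p1 p2 (D \<eta>) \<noteq> 0"
  shows "componentwise_analytic (\<lambda>\<eta>. complex_of_real (kt s \<psi> \<psi>' t1 t2 p1 p2 (D \<eta>) * J \<eta>))"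
proof -
  define X Y where "X \<eta> = ref_map p1 (fst (D \<eta>))" and "Y \<eta> = ref_map p2 (snd (D \<eta>))" for \<eta>
  define n where "n \<eta> = (affine_ext \<psi> t1 (X \<eta>) - affine_ext \<psi> t2 (Y \<eta>)) *
     (affine_ext \<psi>' t1 (X \<eta>) - affine_ext \<psi>' t2 (Y \<eta>)) *
     \<bar>det (ref_matrix p1)\<bar> * \<bar>det (ref_matrix p2)\<bar> * J \<eta>" for \<eta>
  define q where "q \<eta> = (X \<eta> - Y \<eta>) \<bullet> (X \<eta> - Y \<eta>)" for \<eta>
  have X: "componentwise_entire (\<lambda>\<eta>. X \<eta> $ l)" and Y: "componentwise_entire (\<lambda>\<eta>. Y \<eta> $ l)" for l
    unfolding X_def Y_def using assms(5)
    by (auto simp: componentwise_entire_transf_def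
        intro!: componentwise_entire_affine_fun[OF affine_fun_ref_map])
  have "componentwise_entire n"
    unfolding n_def using assms(5)
    by (intro componentwise_entire_intros componentwise_entire_affine_fun[OF assms(1)]
        componentwise_entire_affine_fun[OF assms(2)] componentwise_entire_affine_fun[OF assms(3)]
        componentwise_entire_affine_fun[OF assms(4)] X Y)
      (simp add: componentwise_entire_transf_def)
  moreover have "componentwise_entire q"
    unfolding q_def inner_vec_def sum_3 vector_minus_component inner_real_def
    by (intro componentwise_entire_intros X Y)
  moreover have "0 < q \<eta>" if "\<eta> \<in> unit_cube" for \<eta>
    using nz[OF that] by (auto simp: q_def kt_denom_def X_def Y_def case_prod_beta)
  ultimately have "componentwise_analytic
      (\<lambda>\<eta>. complex_of_real (n \<eta> * q \<eta> powr (- ((3 + 2 * s) / 2))))"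
    by (rule componentwise_analytic_mult_powr)
  \<comment> \<open>This holds for every \<open>\<eta>\<close>, also off the cube: where the image
    points coincide, both sides are 0 by the conventions for division by 0 and for
    \<open>0 powr a\<close>.\<close>
  moreover have "kt s \<psi> \<psi>' t1 t2 p1 p2 (D \<eta>) * J \<eta> = n \<eta> * q \<eta> powr (- ((3 + 2 * s) / 2))" for \<eta>
    by (simp add: kt_def kt_denom_def case_prod_beta n_def q_def X_def Y_def norm_powr_eq
        powr_minus_divide)
  ultimately show ?thesis
    by simp
qed

text \<open>Treats the four configurations at once, with \<open>k\<close> the number of common
  vertices. Separation yields nonzero denominators, and these yield analyticity of each
  summand.\<close>

lemma regularized_kt:
  assumes "3 simplex t1" "3 simplex t2" "0 < k" "k \<le> 4"
    and "affine_fun (affine_ext \<psi> t1)" "affine_fun (affine_ext \<psi> t2)"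
    and "affine_fun (affine_ext \<psi>' t1)" "affine_fun (affine_ext \<psi>' t2)"
    and "\<forall>T \<in> set Ds. componentwise_entire_transf T"
    and "\<And>\<eta>. \<eta> \<in> unit_cube \<Longrightarrow> \<forall>(D, J) \<in> set Ds. separated k (D \<eta>)"
  shows "common_vertices_first k t1 t2 p1 p2 \<longrightarrow> denom_nonzero Ds (kt_denom s p1 p2) \<and>
    componentwise_analytic (\<lambda>\<eta>. complex_of_real (regularized Ds (kt s \<psi> \<psi>' t1 t2 p1 p2) \<eta>))"
proof
  assume "common_vertices_first k t1 t2 p1 p2"
  then have nz: "denom_nonzero Ds (kt_denom s p1 p2)"
    using kt_denom_nonzero[OF assms(1,2) _ assms(3,4)] assms(10)
    unfolding denom_nonzero_def by fast
  moreover have "componentwise_analytic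
      (\<lambda>\<eta>. complex_of_real (regularized Ds (kt s \<psi> \<psi>' t1 t2 p1 p2) \<eta>))"
    using nz unfolding denom_nonzero_def
    by (intro componentwise_analytic_regularized componentwise_analytic_kt assms(5-8) bspec[OF assms(9)]) fast+
  ultimately show "denom_nonzero Ds (kt_denom s p1 p2) \<and>
      componentwise_analytic
        (\<lambda>\<eta>. complex_of_real (regularized Ds (kt s \<psi> \<psi>' t1 t2 p1 p2) \<eta>))"
    by blast
qed

theorem lemma4p8:
  fixes s \<theta> c1 c2 cA :: real
    and \<Omega> t1 t2 :: "(real ^ 3) set"
    and \<T> :: "(real ^ 3) set set"
    and N i j :: nat
    and \<phi> :: "nat \<Rightarrow> real ^ 3 \<Rightarrow> real"
    and p1 p2 :: "(real ^ 3) list"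
  assumes "0 < s" and "s < 1"
    and "admissible_mesh \<Omega> \<T> \<theta> c1 c2 cA"
    and "nodal_basis \<Omega> \<T> N \<phi>"
    and "i \<in> {1..N}" and "j \<in> {1..N}"
    and "t1 \<in> \<T>" and "t2 \<in> \<T>"
  shows
    "(common_vertices_first 4 t1 t2 p1 p2 \<longrightarrow>
        denom_nonzero transf_T (kt_denom s p1 p2) \<and>
        componentwise_analytic
          (\<lambda>\<eta>. complex_of_real (regularized transf_T (kt s (\<phi> i) (\<phi> j) t1 t2 p1 p2) \<eta>))) \<and>
     (common_vertices_first 3 t1 t2 p1 p2 \<longrightarrow>
        denom_nonzero transf_F (kt_denom s p1 p2) \<and>
        componentwise_analytic
          (\<lambda>\<eta>. complex_of_real (regularized transf_F (kt s (\<phi> i) (\<phi> j) t1 t2 p1 p2) \<eta>))) \<and>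
     (common_vertices_first 2 t1 t2 p1 p2 \<longrightarrow>
        denom_nonzero transf_E (kt_denom s p1 p2) \<and>
        componentwise_analytic
          (\<lambda>\<eta>. complex_of_real (regularized transf_E (kt s (\<phi> i) (\<phi> j) t1 t2 p1 p2) \<eta>))) \<and>
     (common_vertices_first 1 t1 t2 p1 p2 \<longrightarrow>
        denom_nonzero transf_V (kt_denom s p1 p2) \<and>
        componentwise_analytic
          (\<lambda>\<eta>. complex_of_real (regularized transf_V (kt s (\<phi> i) (\<phi> j) t1 t2 p1 p2) \<eta>)))"
proof -
  have simplex: "3 simplex t1" "3 simplex t2"
    using assms(3,7,8)
    by (auto simp: admissible_mesh_def conforming_tetrahedral_partition_def)
  \<comment> \<open>Membership in \<open>p1_space\<close> makes each basis function affine on each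
    tetrahedron, so its affine extension is well defined there.\<close>
  have aff: "affine_fun (affine_ext (\<phi> m) t)" if "m \<in> {1..N}" "t \<in> \<T>" for m t
  proof -
    have "\<phi> m \<in> p1_space \<Omega> \<T>"
      using assms(4) that(1) unfolding nodal_basis_def by blast
    then obtain f where "affine_fun f" "\<And>x. x \<in> t \<Longrightarrow> \<phi> m x = f x"
      using \<open>t \<in> \<T>\<close> unfolding p1_space_def by blast
    moreover have "3 simplex t"
      using assms(3) that(2)
      by (auto simp: admissible_mesh_def conforming_tetrahedral_partition_def)
    ultimately show ?thesis
      using affine_ext_affine_fun by blast
  qed
  note aff' = aff[OF assms(5,7)] aff[OF assms(5,8)] aff[OF assms(6,7)] aff[OF assms(6,8)]
  show ?thesis
    by (intro conjI regularized_kt simplex aff' componentwise_entire_transfs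
        separated_transf_V separated_transf_E separated_transf_F separated_transf_T; simp)
qed

end
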